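(* Let $\mathcal I$ and $\mathcal J$ be tall summable ideals on $\omega$, with dual filters $\mathcal I^*$ and $\mathcal J^*$. Then the complete Boolean algebra $\mathrm{RO}(\mathbb M(\mathcal I^* ))$ is completely embedded in $\mathrm{RO}(\mathbb M(\mathcal J^* ))$.
   Context: All ideals and filters on $\omega$ are proper; ideals contain all finite sets and filters contain all cofinite sets. An ideal $\mathcal I$ on $\omega$ is summable if there is a function $\mu\colon\omega\to[0,\infty)$ such that $\mathcal I=\{I\subseteq\omega : \sum_{i\in I}\mu(i)<\infty\}$. It is tall if every infinite $A\subseteq\omega$ has an infinite subset belonging to $\mathcal I$. The dual filter is $\mathcal I^*=\{\omega\setminus I : I\in\mathcal I\}$. For a filter $\mathcal F$ on $\omega$, the Mathias--Prikry forcing $\mathbb M(\mathcal F)$ consists of pairs $(s,A)$ with $s$ a finite subset of $\omega$ and $A\in\mathcal F$, ordered by $(s,A)\le(t,B)$ iff $t\sqsubseteq s$ (i.e. $t=s\cap n$ for some $n\in\omega$), $A\subseteq B$, and $s\setminus t\subseteq B$. For a poset $P$, $\mathrm{RO}(P)$ denotes the unique (up to isomorphism) complete Boolean algebra into whose nonzero elements $P$ densely embeds (preserving order and incompatibility). A complete embedding of complete Boolean algebras is an injective Boolean homomorphism preserving arbitrary suprema and infima. *)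

theory Defs
  imports "HOL-Analysis.Infinite_Sum" "HOL-Algebra.Complete_Lattice"
begin

section \<open>Ideals and filters on the natural numbers\<close>

definition is_ideal :: "nat set set \<Rightarrow> bool" where
  "is_ideal I \<longleftrightarrow>
     (\<forall>X\<in>I. \<forall>Y\<subseteq>X. Y \<in> I) \<and>
     (\<forall>X\<in>I. \<forall>Y\<in>I. X \<union> Y \<in> I) \<and>
     (\<forall>X. finite X \<longrightarrow> X \<in> I) \<and>
     UNIV \<notin> I"

definition is_filter_set :: "nat set set \<Rightarrow> bool" where
  "is_filter_set F \<longleftrightarrow>
     (\<forall>X\<in>F. \<forall>Y. X \<subseteq> Y \<longrightarrow> Y \<in> F) \<and>
     (\<forall>X\<in>F. \<forall>Y\<in>F. X \<inter> Y \<in> F) \<and>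
     (\<forall>X. finite (- X) \<longrightarrow> X \<in> F) \<and>
     {} \<notin> F"

definition summable_ideal :: "nat set set \<Rightarrow> bool" where
  "summable_ideal I \<longleftrightarrow> is_ideal I \<and>
     (\<exists>\<mu> :: nat \<Rightarrow> real. (\<forall>i. 0 \<le> \<mu> i) \<and> I = {X. \<mu> summable_on X})"

definition tall :: "nat set set \<Rightarrow> bool" where
  "tall I \<longleftrightarrow> (\<forall>A. infinite A \<longrightarrow> (\<exists>X\<subseteq>A. infinite X \<and> X \<in> I))"

definition dual_filter :: "nat set set \<Rightarrow> nat set set" where
  "dual_filter I = {UNIV - X | X. X \<in> I}"

lemma mem_dual_filter: "A \<in> dual_filter I \<longleftrightarrow> - A \<in> I"
  unfolding dual_filter_def by (auto simp: Compl_eq_Diff_UNIV double_diff intro!: exI[of _ "UNIV - A"])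

lemma is_filter_set_dual_filter:
  assumes "is_ideal I"
  shows "is_filter_set (dual_filter I)"
proof -
  have "- Y \<in> I" if "- X \<in> I" "X \<subseteq> Y" for X Y
    using assms that unfolding is_ideal_def by (meson Compl_anti_mono)
  then show ?thesis
    using assms unfolding is_filter_set_def is_ideal_def by (auto simp: mem_dual_filter)
qed


section \<open>Mathias--Prikry forcing\<close>

definition initial_segment :: "nat set \<Rightarrow> nat set \<Rightarrow> bool" where
  "initial_segment t s \<longleftrightarrow> (\<exists>n. t = s \<inter> {..<n})"

definition Mathias_Prikry :: "nat set set \<Rightarrow> (nat set \<times> nat set) gorder" where
  "Mathias_Prikry F =
     \<lparr>carrier = {(s, A). finite s \<and> A \<in> F}, eq = (=),
      le = (\<lambda>(s, A) (t, B). initial_segment t s \<and> A \<subseteq> B \<and> s - t \<subseteq> B)\<rparr>"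

lemma initial_segment_refl: "finite s \<Longrightarrow> initial_segment s s"
proof -
  assume "finite s"
  then obtain n where "s \<subseteq> {..<n}"
    using finite_nat_iff_bounded by blast
  then show ?thesis
    unfolding initial_segment_def by blast
qed

lemma initial_segment_trans:
  "initial_segment t s \<Longrightarrow> initial_segment u t \<Longrightarrow> initial_segment u s"
proof -
  assume "initial_segment t s" "initial_segment u t"
  then obtain m n where "t = s \<inter> {..<m}" "u = t \<inter> {..<n}"
    unfolding initial_segment_def by blast
  then have "u = s \<inter> {..<min m n}"
    by auto
  then show ?thesis
    unfolding initial_segment_def by blast
qed

lemma initial_segment_subset: "initial_segment t s \<Longrightarrow> t \<subseteq> s"
  unfolding initial_segment_def by blast

lemma partial_order_Mathias_Prikry: "partial_order (Mathias_Prikry F)"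
proof (unfold_locales, goal_cases)
  case (6 x y z)
  then show ?case
    unfolding Mathias_Prikry_def by (auto dest: initial_segment_trans)
qed (auto simp: Mathias_Prikry_def initial_segment_refl dest: initial_segment_subset)


section \<open>Complete Boolean algebras\<close>

text \<open>The type class of complete Boolean algebras in HOL postulates complete distributivity,
  which forces the algebra to be atomic.  Only finite distributivity is assumed here.\<close>

locale complete_boolean_lattice = complete_lattice L for L (structure) +
  assumes distrib:
      "\<lbrakk>x \<in> carrier L; y \<in> carrier L; z \<in> carrier L\<rbrakk>
       \<Longrightarrow> x \<sqinter> (y \<squnion> z) = (x \<sqinter> y) \<squnion> (x \<sqinter> z)"
    and complemented:
      "x \<in> carrier L \<Longrightarrow> \<exists>y\<in>carrier L. x \<sqinter> y = \<bottom> \<and> x \<squnion> y = \<top>"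

definition complement :: "('a, 'm) gorder_scheme \<Rightarrow> 'a \<Rightarrow> 'a" where
  "complement L x = (THE y. y \<in> carrier L \<and> x \<sqinter>\<^bsub>L\<^esub> y = \<bottom>\<^bsub>L\<^esub> \<and> x \<squnion>\<^bsub>L\<^esub> y = \<top>\<^bsub>L\<^esub>)"

definition boolean_hom :: "('a, 'm) gorder_scheme \<Rightarrow> ('b, 'n) gorder_scheme \<Rightarrow> ('a \<Rightarrow> 'b) \<Rightarrow> bool" where
  "boolean_hom L M f \<longleftrightarrow>
     f \<in> carrier L \<rightarrow> carrier M \<and>
     f \<bottom>\<^bsub>L\<^esub> = \<bottom>\<^bsub>M\<^esub> \<and> f \<top>\<^bsub>L\<^esub> = \<top>\<^bsub>M\<^esub> \<and>
     (\<forall>x\<in>carrier L. \<forall>y\<in>carrier L. f (x \<sqinter>\<^bsub>L\<^esub> y) = f x \<sqinter>\<^bsub>M\<^esub> f y) \<and>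
     (\<forall>x\<in>carrier L. \<forall>y\<in>carrier L. f (x \<squnion>\<^bsub>L\<^esub> y) = f x \<squnion>\<^bsub>M\<^esub> f y) \<and>
     (\<forall>x\<in>carrier L. f (complement L x) = complement M (f x))"

definition complete_embedding :: "('a, 'm) gorder_scheme \<Rightarrow> ('b, 'n) gorder_scheme \<Rightarrow> ('a \<Rightarrow> 'b) \<Rightarrow> bool" where
  "complete_embedding L M f \<longleftrightarrow>
     boolean_hom L M f \<and> inj_on f (carrier L) \<and> sup_pres L M f \<and> inf_pres L M f"


section \<open>Boolean completions of posets\<close>

definition incompatible :: "('p, 'm) gorder_scheme \<Rightarrow> 'p \<Rightarrow> 'p \<Rightarrow> bool" where
  "incompatible P p q \<longleftrightarrow> \<not> (\<exists>r\<in>carrier P. r \<sqsubseteq>\<^bsub>P\<^esub> p \<and> r \<sqsubseteq>\<^bsub>P\<^esub> q)"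

text \<open>As usual in forcing, a dense embedding need not be injective: Mathias--Prikry forcing
  is not separative, and conditions compatible with the same conditions
  necessarily get the same image.\<close>

definition dense_embedding :: "('p, 'm) gorder_scheme \<Rightarrow> ('b, 'n) gorder_scheme \<Rightarrow> ('p \<Rightarrow> 'b) \<Rightarrow> bool" where
  "dense_embedding P B e \<longleftrightarrow>
     e \<in> carrier P \<rightarrow> carrier B - {\<bottom>\<^bsub>B\<^esub>} \<and>
     (\<forall>p\<in>carrier P. \<forall>q\<in>carrier P. p \<sqsubseteq>\<^bsub>P\<^esub> q \<longrightarrow> e p \<sqsubseteq>\<^bsub>B\<^esub> e q) \<and>
     (\<forall>p\<in>carrier P. \<forall>q\<in>carrier P. incompatible P p q \<longrightarrow> e p \<sqinter>\<^bsub>B\<^esub> e q = \<bottom>\<^bsub>B\<^esub>) \<and>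
     (\<forall>b\<in>carrier B - {\<bottom>\<^bsub>B\<^esub>}. \<exists>p\<in>carrier P. e p \<sqsubseteq>\<^bsub>B\<^esub> b)"

text \<open>\<open>is_RO P B\<close> says that \<open>B\<close> is (a copy of) the algebra usually written \<open>RO(P)\<close>.
  A copy whose elements are sets of conditions is constructed in \<open>is_RO_regular_open\<close> below.\<close>

definition is_RO :: "('p, 'm) gorder_scheme \<Rightarrow> ('b, 'n) gorder_scheme \<Rightarrow> bool" where
  "is_RO P B \<longleftrightarrow> complete_boolean_lattice B \<and> (\<exists>e. dense_embedding P B e)"


subsection \<open>Existence\<close>

definition perp :: "('p, 'm) gorder_scheme \<Rightarrow> 'p set \<Rightarrow> 'p set" where
  "perp P U = {p \<in> carrier P. \<forall>u\<in>U. incompatible P p u}"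

definition regular_open :: "('p, 'm) gorder_scheme \<Rightarrow> 'p set gorder" where
  "regular_open P =
     \<lparr>carrier = {U. U \<subseteq> carrier P \<and> perp P (perp P U) = U}, eq = (=), le = (\<subseteq>)\<rparr>"

context partial_order
begin

lemma incompatible_sym: "incompatible L p q \<Longrightarrow> incompatible L q p"
  unfolding incompatible_def by blast

lemma perp_subset: "perp L U \<subseteq> carrier L"
  unfolding perp_def by blast

lemma perp_antimono: "U \<subseteq> V \<Longrightarrow> perp L V \<subseteq> perp L U"
  unfolding perp_def by blast

lemma perp_perp_extensive: "U \<subseteq> carrier L \<Longrightarrow> U \<subseteq> perp L (perp L U)"
  unfolding perp_def by (auto intro: incompatible_sym)

lemma perp3: "U \<subseteq> carrier L \<Longrightarrow> perp L (perp L (perp L U)) = perp L U"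
  by (meson perp_antimono perp_perp_extensive perp_subset subset_antisym)

lemma perp_down:
  "p \<in> perp L U \<Longrightarrow> q \<in> carrier L \<Longrightarrow> q \<sqsubseteq> p \<Longrightarrow> U \<subseteq> carrier L \<Longrightarrow> q \<in> perp L U"
  unfolding perp_def incompatible_def by (auto) (meson le_trans subsetD)

lemma carrier_RO:
  "U \<in> carrier (regular_open L) \<longleftrightarrow> U \<subseteq> carrier L \<and> perp L (perp L U) = U"
  unfolding regular_open_def by simp

lemma le_RO: "le (regular_open L) = (\<subseteq>)"
  unfolding regular_open_def by simp

lemma perp_in_RO: "U \<subseteq> carrier L \<Longrightarrow> perp L U \<in> carrier (regular_open L)"
  by (simp add: carrier_RO perp_subset perp3)

lemma perp_Int_self: "U \<subseteq> carrier L \<Longrightarrow> U \<inter> perp L U = {}"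
  unfolding perp_def incompatible_def using le_refl by fast

lemma RO_down:
  "U \<in> carrier (regular_open L) \<Longrightarrow> p \<in> U \<Longrightarrow> q \<in> carrier L \<Longrightarrow> q \<sqsubseteq> p \<Longrightarrow> q \<in> U"
  using perp_down[of p "perp L U" q] perp_subset[of U] by (simp add: carrier_RO)

lemma partial_order_RO: "partial_order (regular_open L)"
  by unfold_locales (auto simp: regular_open_def)

lemma RO_inter:
  assumes "S \<subseteq> carrier (regular_open L)"
  shows "carrier L \<inter> \<Inter>S \<in> carrier (regular_open L)"
proof -
  let ?M = "carrier L \<inter> \<Inter>S"
  have "perp L (perp L ?M) \<subseteq> U" if "U \<in> S" for U
  proof -
    have "perp L (perp L ?M) \<subseteq> perp L (perp L U)"
      by (intro perp_antimono) (use that in blast)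
    then show ?thesis using that assms carrier_RO by blast
  qed
  then have "perp L (perp L ?M) \<subseteq> ?M"
    using perp_subset by blast
  then show ?thesis
    using perp_perp_extensive[of ?M] carrier_RO by blast
qed

lemma glb_RO:
  assumes "S \<subseteq> carrier (regular_open L)"
  shows "greatest (regular_open L) (carrier L \<inter> \<Inter>S) (Lower (regular_open L) S)"
proof (rule greatest_LowerI)
  show "y \<sqsubseteq>\<^bsub>regular_open L\<^esub> carrier L \<inter> \<Inter>S"
    if "y \<in> Lower (regular_open L) S" for y
  proof -
    have "y \<in> carrier (regular_open L)" "\<forall>X\<in>S. y \<subseteq> X"
      using that assms unfolding Lower_def by (auto simp: le_RO)
    then show ?thesis
      using carrier_RO by (auto simp: le_RO)
  qed
qed (use RO_inter[OF assms] assms in \<open>auto simp: le_RO\<close>)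

lemma lub_RO:
  assumes "S \<subseteq> carrier (regular_open L)"
  shows "least (regular_open L) (perp L (perp L (\<Union>S))) (Upper (regular_open L) S)"
proof -
  have sub: "\<Union>S \<subseteq> carrier L"
    using assms carrier_RO by blast
  show ?thesis
  proof (rule least_UpperI)
    show "x \<sqsubseteq>\<^bsub>regular_open L\<^esub> perp L (perp L (\<Union>S))" if "x \<in> S" for x
      using perp_perp_extensive[OF sub] that by (auto simp: le_RO)
    show "perp L (perp L (\<Union>S)) \<sqsubseteq>\<^bsub>regular_open L\<^esub> y"
      if "y \<in> Upper (regular_open L) S" for y
    proof -
      have y: "y \<in> carrier (regular_open L)" "\<Union>S \<subseteq> y"
        using that assms unfolding Upper_def by (auto simp: le_RO)
      have "perp L (perp L (\<Union>S)) \<subseteq> perp L (perp L y)"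
        by (intro perp_antimono y)
      then show ?thesis
        using y(1) by (simp add: le_RO carrier_RO)
    qed
    show "perp L (perp L (\<Union>S)) \<in> carrier (regular_open L)"
      by (simp add: perp_in_RO perp_subset)
  qed (rule assms)
qed

lemma complete_lattice_RO: "complete_lattice (regular_open L)"
  by (rule partial_order.complete_latticeI[OF partial_order_RO]) (blast intro: glb_RO lub_RO)+

lemma RO_ops:
  shows "x \<in> carrier (regular_open L) \<Longrightarrow> y \<in> carrier (regular_open L) \<Longrightarrow>
           x \<sqinter>\<^bsub>regular_open L\<^esub> y = x \<inter> y"
    and "x \<in> carrier (regular_open L) \<Longrightarrow> y \<in> carrier (regular_open L) \<Longrightarrow>
           x \<squnion>\<^bsub>regular_open L\<^esub> y = perp L (perp L (x \<union> y))"
    and "\<bottom>\<^bsub>regular_open L\<^esub> = {}"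
    and "\<top>\<^bsub>regular_open L\<^esub> = carrier L"
proof -
  interpret RO: complete_lattice "regular_open L"
    by (rule complete_lattice_RO)
  have infeq: "\<Sqinter>\<^bsub>regular_open L\<^esub> S = carrier L \<inter> \<Inter>S" if "S \<subseteq> carrier (regular_open L)" for S
    using RO.inf_glb[OF that] glb_RO[OF that] RO.greatest_unique by blast
  have supeq: "\<Squnion>\<^bsub>regular_open L\<^esub> S = perp L (perp L (\<Union>S))"
    if "S \<subseteq> carrier (regular_open L)" for S
    using RO.sup_lub[OF that] lub_RO[OF that] RO.least_unique by blast
  show "x \<sqinter>\<^bsub>regular_open L\<^esub> y = x \<inter> y"
    if "x \<in> carrier (regular_open L)" "y \<in> carrier (regular_open L)"
    using that infeq[of "{x, y}"] carrier_RO unfolding meet_def by auto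
  show "x \<squnion>\<^bsub>regular_open L\<^esub> y = perp L (perp L (x \<union> y))"
    if "x \<in> carrier (regular_open L)" "y \<in> carrier (regular_open L)"
    using that supeq[of "{x, y}"] unfolding join_def by auto
  have "perp L (perp L {}) = {}"
    using perp_Int_self[of "carrier L"] unfolding perp_def by auto
  then have e: "{} \<in> carrier (regular_open L)"
    by (simp add: carrier_RO)
  show "\<bottom>\<^bsub>regular_open L\<^esub> = {}"
    using RO.bottom_lower[OF e] by (simp add: regular_open_def)
  have "carrier L \<in> carrier (regular_open L)"
    using RO_inter[of "{}"] by simp
  then show "\<top>\<^bsub>regular_open L\<^esub> = carrier L"
    using RO.top_higher[of "carrier L"] RO.top_closed
    by (auto simp: regular_open_def)
qed

lemma mem_perp_perp_iff:
  assumes "U \<subseteq> carrier L" "p \<in> carrier L" "\<And>p q. p \<in> U \<Longrightarrow> q \<in> carrier L \<Longrightarrow> q \<sqsubseteq> p \<Longrightarrow> q \<in> U"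
  shows "p \<in> perp L (perp L U) \<longleftrightarrow> (\<forall>q\<in>carrier L. q \<sqsubseteq> p \<longrightarrow> (\<exists>r\<in>U. r \<sqsubseteq> q))"
proof
  assume p: "p \<in> perp L (perp L U)"
  show "\<forall>q\<in>carrier L. q \<sqsubseteq> p \<longrightarrow> (\<exists>r\<in>U. r \<sqsubseteq> q)"
  proof (intro ballI impI)
    fix q assume q: "q \<in> carrier L" "q \<sqsubseteq> p"
    then have "q \<notin> perp L U"
      using p le_refl unfolding perp_def incompatible_def by blast
    then obtain u r where "u \<in> U" "r \<in> carrier L" "r \<sqsubseteq> q" "r \<sqsubseteq> u"
      using q unfolding perp_def incompatible_def by blast
    then show "\<exists>r\<in>U. r \<sqsubseteq> q"
      using assms(3) by blast
  qed
next
  assume R: "\<forall>q\<in>carrier L. q \<sqsubseteq> p \<longrightarrow> (\<exists>r\<in>U. r \<sqsubseteq> q)"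
  have "incompatible L p v" if v: "v \<in> perp L U" for v
    unfolding incompatible_def
  proof
    assume "\<exists>r\<in>carrier L. r \<sqsubseteq> p \<and> r \<sqsubseteq> v"
    then obtain r where r: "r \<in> carrier L" "r \<sqsubseteq> p" "r \<sqsubseteq> v" by blast
    then obtain u where u: "u \<in> U" "u \<sqsubseteq> r" using R by blast
    have "u \<in> perp L U"
      using perp_down[OF v, of u] le_trans[of u r v] r u v assms(1) perp_subset by blast
    then show False
      using perp_Int_self[OF assms(1)] u by blast
  qed
  then show "p \<in> perp L (perp L U)"
    using assms(2) unfolding perp_def by blast
qed

lemma complete_boolean_RO: "complete_boolean_lattice (regular_open L)"
proof -
  interpret RO: complete_lattice "regular_open L"
    by (rule complete_lattice_RO)
  show ?thesis
  proof
    fix x y z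
    assume c: "x \<in> carrier (regular_open L)" "y \<in> carrier (regular_open L)"
      "z \<in> carrier (regular_open L)"
    have sub: "x \<subseteq> carrier L" "y \<subseteq> carrier L" "z \<subseteq> carrier L"
      using c carrier_RO by auto
    have cl: "x \<inter> y \<in> carrier (regular_open L)" "x \<inter> z \<in> carrier (regular_open L)"
      "perp L (perp L (y \<union> z)) \<in> carrier (regular_open L)"
      using RO.meet_closed c RO_ops(1) perp_in_RO perp_subset by metis+
    have "x \<inter> perp L (perp L (y \<union> z)) = perp L (perp L (x \<inter> y \<union> x \<inter> z))"
    proof
      show "x \<inter> perp L (perp L (y \<union> z)) \<subseteq> perp L (perp L (x \<inter> y \<union> x \<inter> z))"
      proof
        fix p assume p: "p \<in> x \<inter> perp L (perp L (y \<union> z))"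
        then have pc: "p \<in> carrier L" using sub by blast
        have "\<exists>r\<in>x \<inter> y \<union> x \<inter> z. r \<sqsubseteq> q" if q: "q \<in> carrier L" "q \<sqsubseteq> p" for q
        proof -
          have "q \<in> x" using RO_down[OF c(1)] p q by blast
          moreover obtain r where r: "r \<in> y \<union> z" "r \<sqsubseteq> q"
            using mem_perp_perp_iff[of "y \<union> z" p] RO_down[OF c(2)] RO_down[OF c(3)] p pc q sub
            by (metis IntD2 Un_iff Un_subset_iff)
          ultimately have "r \<in> x" using RO_down[OF c(1)] sub by blast
          then show ?thesis using r by blast
        qed
        then show "p \<in> perp L (perp L (x \<inter> y \<union> x \<inter> z))"
          using mem_perp_perp_iff[of "x \<inter> y \<union> x \<inter> z" p] RO_down[OF cl(1)] RO_down[OF cl(2)] pc sub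
          by (metis Un_iff Un_subset_iff le_infI1)
      qed
      have "perp L (perp L (x \<inter> y \<union> x \<inter> z)) \<subseteq> perp L (perp L x)"
        "perp L (perp L (x \<inter> y \<union> x \<inter> z)) \<subseteq> perp L (perp L (y \<union> z))"
        by (intro perp_antimono; blast)+
      then show "perp L (perp L (x \<inter> y \<union> x \<inter> z)) \<subseteq> x \<inter> perp L (perp L (y \<union> z))"
        using c(1) carrier_RO by blast
    qed
    then show "x \<sqinter>\<^bsub>regular_open L\<^esub> (y \<squnion>\<^bsub>regular_open L\<^esub> z) =
      (x \<sqinter>\<^bsub>regular_open L\<^esub> y) \<squnion>\<^bsub>regular_open L\<^esub> (x \<sqinter>\<^bsub>regular_open L\<^esub> z)"
      using c cl by (simp add: RO_ops)
  next
    fix x assume c: "x \<in> carrier (regular_open L)"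
    then have sub: "x \<subseteq> carrier L" by (simp add: carrier_RO)
    have "perp L (x \<union> perp L x) = {}"
      using perp_Int_self[OF perp_subset[of x]] unfolding perp_def by blast
    moreover have "perp L {} = carrier L" unfolding perp_def by simp
    ultimately show "\<exists>y\<in>carrier (regular_open L).
        x \<sqinter>\<^bsub>regular_open L\<^esub> y = \<bottom>\<^bsub>regular_open L\<^esub> \<and>
        x \<squnion>\<^bsub>regular_open L\<^esub> y = \<top>\<^bsub>regular_open L\<^esub>"
      using c perp_in_RO[OF sub] perp_Int_self[OF sub]
      by (intro bexI[of _ "perp L x"]) (simp_all add: RO_ops)
  qed
qed

lemma dense_embedding_RO:
  "dense_embedding L (regular_open L) (\<lambda>p. perp L (perp L {q \<in> carrier L. q \<sqsubseteq> p}))"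
proof -
  let ?d = "\<lambda>p. {q \<in> carrier L. q \<sqsubseteq> p}"
  let ?e = "\<lambda>p. perp L (perp L (?d p))"
  have d: "?d p \<subseteq> carrier L" for p by blast
  have e: "?e p \<in> carrier (regular_open L)" for p
    by (simp add: perp_in_RO perp_subset)
  have sub: "?d p \<subseteq> ?e p" for p by (rule perp_perp_extensive[OF d])
  have "?e p \<noteq> {}" if "p \<in> carrier L" for p
    using sub[of p] le_refl[OF that] that by blast
  moreover have "?e p \<subseteq> ?e q" if "p \<in> carrier L" "q \<in> carrier L" "p \<sqsubseteq> q" for p q
    by (intro perp_antimono) (use that le_trans in blast)
  moreover have "?e p \<inter> ?e q = {}" if "p \<in> carrier L" "q \<in> carrier L" "incompatible L p q" for p q
  proof -
    have "?d p \<subseteq> perp L (?d q)"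
      using that le_trans unfolding perp_def incompatible_def by blast
    then have "?e p \<subseteq> perp L (perp L (perp L (?d q)))"
      by (intro perp_antimono)
    then show ?thesis
      using perp_Int_self[OF perp_subset[of "perp L (?d q)"]] by blast
  qed
  moreover have "\<exists>p\<in>carrier L. ?e p \<subseteq> b" if b: "b \<in> carrier (regular_open L)" "b \<noteq> {}" for b
  proof -
    obtain p where p: "p \<in> b" "p \<in> carrier L" using b carrier_RO by blast
    then have "?d p \<subseteq> b" using RO_down[OF b(1)] by blast
    then have "?e p \<subseteq> perp L (perp L b)" by (intro perp_antimono)
    then show ?thesis using p b carrier_RO by auto
  qed
  moreover have "le (regular_open L) = (\<subseteq>)" by (simp add: regular_open_def)
  ultimately show ?thesis
    unfolding dense_embedding_def using e by (auto simp: RO_ops)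
qed

theorem is_RO_regular_open: "is_RO L (regular_open L)"
  unfolding is_RO_def using complete_boolean_RO dense_embedding_RO by blast

end

end

theory Submission
  imports Defs "HOL-Analysis.Elementary_Metric_Spaces"
begin

text \<open>Let \<open>\<nu>\<close> and \<open>\<mu>\<close> be the weights of \<open>I\<close> and \<open>J\<close>.  Tallness of \<open>J\<close> means that
  \<open>\<mu>\<close> tends to \<open>0\<close>, and properness that its sum diverges, so one can cut out of \<open>\<omega>\<close> consecutive
  finite blocks \<open>b n\<close> whose measure lies between \<open>\<nu> n\<close> and \<open>\<nu> n + (1/2) ^ n\<close>.  Then a union of blocks
  over a set in \<open>I\<close> is in \<open>J\<close>, and a set in \<open>J\<close> contains only \<open>I\<close>-many blocks.  Sending a set to
  the indices of the blocks that it meets therefore turns a generic real for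
  \<open>J\<^sup>*\<close> into one for \<open>I\<^sup>*\<close>: on conditions this is a projection, and a projection of posets
  induces a complete embedding of their completions in the opposite direction.\<close>

section \<open>Complements in complete Boolean algebras\<close>

context complete_boolean_lattice
begin

text \<open>If u is disjoint from x and v joins with x to the top, distributing u over the join of x
  and v shows that u is the meet of u and v. Two complements therefore lie below each other, which
  makes the definite description in \<open>complement\<close> meaningful.\<close>

lemma complement_unique:
  assumes "x \<in> carrier L" "y \<in> carrier L" "z \<in> carrier L"
    and "x \<sqinter> y = \<bottom>" "x \<squnion> y = \<top>" "x \<sqinter> z = \<bottom>" "x \<squnion> z = \<top>"
  shows "y = z"
proof -
  have le: "u \<sqsubseteq> v"
    if "u \<in> carrier L" "v \<in> carrier L" "x \<sqinter> u = \<bottom>" "x \<squnion> v = \<top>" for u v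
  proof -
    have "u \<sqinter> (x \<squnion> v) = (u \<sqinter> x) \<squnion> (u \<sqinter> v)"
      using that assms(1) by (intro distrib)
    also have "u \<sqinter> (x \<squnion> v) = u"
      using that by (metis le_iff_join top_closed top_higher)
    also have "u \<sqinter> x = \<bottom>"
      using that meet_comm by metis
    also have "\<bottom> \<squnion> (u \<sqinter> v) = u \<sqinter> v"
      using that by (metis bottom_closed bottom_lower le_iff_meet meet_closed)
    finally show ?thesis
      using that meet_right by metis
  qed
  show ?thesis
    using le[of y z] le[of z y] assms by (intro le_antisym) auto
qed

lemma complement_eq:
  assumes "x \<in> carrier L" "y \<in> carrier L" "x \<sqinter> y = \<bottom>" "x \<squnion> y = \<top>"
  shows "complement L x = y"
  unfolding complement_def
  by (rule the_equality) (use assms complement_unique in blast)+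

lemma complement_props:
  assumes "x \<in> carrier L"
  shows "complement L x \<in> carrier L" "x \<sqinter> complement L x = \<bottom>" "x \<squnion> complement L x = \<top>"
  using complemented[OF assms] complement_eq[OF assms] by auto

text \<open>Splitting y along x and its complement leaves only the second part when x and y are
  disjoint. The complement is thus the largest element disjoint from x.\<close>

lemma le_complement_iff:
  assumes "x \<in> carrier L" "y \<in> carrier L"
  shows "y \<sqsubseteq> complement L x \<longleftrightarrow> x \<sqinter> y = \<bottom>"
proof
  note c = complement_props[OF assms(1)]
  assume "y \<sqsubseteq> complement L x"
  then have "x \<sqinter> y \<sqsubseteq> x \<sqinter> complement L x"
    using assms c(1) by (meson meet_closed meet_le meet_left meet_right le_trans)
  then show "x \<sqinter> y = \<bottom>"
    using assms c(2) by (metis bottom_closed bottom_lower le_antisym meet_closed)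
next
  note c = complement_props[OF assms(1)]
  assume xy: "x \<sqinter> y = \<bottom>"
  have "y = y \<sqinter> (x \<squnion> complement L x)"
    using assms c(3) by (metis le_iff_join top_closed top_higher)
  also have "\<dots> = (y \<sqinter> x) \<squnion> (y \<sqinter> complement L x)"
    using assms c(1) by (intro distrib)
  also have "\<dots> = y \<sqinter> complement L x"
    using assms c(1) xy meet_comm
    by (metis bottom_closed bottom_lower le_iff_meet meet_closed)
  finally show "y \<sqsubseteq> complement L x"
    using assms c(1) meet_right by metis
qed

lemma complement_complement:
  assumes "x \<in> carrier L"
  shows "complement L (complement L x) = x"
  using complement_props[OF assms] assms
  by (intro complement_eq) (simp_all add: meet_comm join_comm)

lemma meet_complement_nonbottom:
  assumes "x \<in> carrier L" "y \<in> carrier L" "\<not> x \<sqsubseteq> y"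
  shows "x \<sqinter> complement L y \<noteq> \<bottom>"
  using le_complement_iff[of "complement L y" x] complement_complement[of y]
    complement_props(1)[of y] meet_comm assms by metis

text \<open>If x were disjoint from every member of S, \<open>complement L x\<close> would be an
  upper bound of S and hence of its supremum. This is the form in which distributivity over infinite
  joins enters.\<close>

lemma meet_sup_nonbottom:
  assumes "x \<in> carrier L" "S \<subseteq> carrier L" "x \<sqinter> \<Squnion>S \<noteq> \<bottom>"
  shows "\<exists>s\<in>S. x \<sqinter> s \<noteq> \<bottom>"
proof (rule ccontr)
  assume "\<not> (\<exists>s\<in>S. x \<sqinter> s \<noteq> \<bottom>)"
  then have "\<Squnion>S \<sqsubseteq> complement L x"
    using assms by (intro sup_least) (auto simp: complement_props le_complement_iff)
  then show False
    using assms by (simp add: le_complement_iff)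
qed

lemma bottom_unless_compatible:
  assumes "x \<in> carrier L" "y \<in> carrier L" "z \<in> carrier L" "x \<sqinter> y = \<bottom>" "z \<sqsubseteq> x" "z \<sqsubseteq> y"
  shows "z = \<bottom>"
  using assms by (metis bottom_closed bottom_lower le_antisym meet_le)

end

section \<open>Projections induce complete embeddings\<close>

locale boolean_completion = P: partial_order P + B: complete_boolean_lattice B
  for P :: "('p, 'm) gorder_scheme" and B :: "('b, 'n) gorder_scheme" +
  fixes e :: "'p \<Rightarrow> 'b"
  assumes dense: "dense_embedding P B e"
begin

lemma closed: "p \<in> carrier P \<Longrightarrow> e p \<in> carrier B"
  and nonbottom: "p \<in> carrier P \<Longrightarrow> e p \<noteq> \<bottom>\<^bsub>B\<^esub>"
  and mono: "p \<in> carrier P \<Longrightarrow> q \<in> carrier P \<Longrightarrow> p \<sqsubseteq>\<^bsub>P\<^esub> q \<Longrightarrow> e p \<sqsubseteq>\<^bsub>B\<^esub> e q"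
  using dense unfolding dense_embedding_def by blast+

lemma below:
  assumes "b \<in> carrier B" "b \<noteq> \<bottom>\<^bsub>B\<^esub>"
  obtains p where "p \<in> carrier P" "e p \<sqsubseteq>\<^bsub>B\<^esub> b"
  using dense assms unfolding dense_embedding_def by blast

lemma compatible:
  assumes "p \<in> carrier P" "q \<in> carrier P" "e p \<sqinter>\<^bsub>B\<^esub> e q \<noteq> \<bottom>\<^bsub>B\<^esub>"
  obtains r where "r \<in> carrier P" "r \<sqsubseteq>\<^bsub>P\<^esub> p" "r \<sqsubseteq>\<^bsub>P\<^esub> q"
  using dense assms unfolding dense_embedding_def incompatible_def by blast

text \<open>Density yields q with \<open>e q\<close> below \<open>e p\<close>, but q need not be
  below p, since the poset may fail to be separative. A common extension of p and q repairs
  this.\<close>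

lemma refine:
  assumes "p \<in> carrier P" "b \<in> carrier B" "e p \<sqinter>\<^bsub>B\<^esub> b \<noteq> \<bottom>\<^bsub>B\<^esub>"
  obtains r where "r \<in> carrier P" "r \<sqsubseteq>\<^bsub>P\<^esub> p" "e r \<sqsubseteq>\<^bsub>B\<^esub> b"
proof -
  have ep: "e p \<in> carrier B" using assms closed by blast
  have m: "e p \<sqinter>\<^bsub>B\<^esub> b \<in> carrier B" using ep assms by simp
  obtain q where q: "q \<in> carrier P" "e q \<sqsubseteq>\<^bsub>B\<^esub> e p \<sqinter>\<^bsub>B\<^esub> b"
    using below[OF m assms(3)] by blast
  have qp: "e q \<sqsubseteq>\<^bsub>B\<^esub> e p" and qb: "e q \<sqsubseteq>\<^bsub>B\<^esub> b"
    by (rule B.le_trans[OF q(2)]; simp add: B.meet_left B.meet_right closed q(1) ep assms(2))+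
  have "e p \<sqinter>\<^bsub>B\<^esub> e q \<noteq> \<bottom>\<^bsub>B\<^esub>"
    using B.bottom_unless_compatible[of "e p" "e q" "e q"] qp q(1) closed nonbottom ep by auto
  then obtain r where r: "r \<in> carrier P" "r \<sqsubseteq>\<^bsub>P\<^esub> p" "r \<sqsubseteq>\<^bsub>P\<^esub> q"
    using compatible[OF assms(1) q(1)] by blast
  then have "e r \<sqsubseteq>\<^bsub>B\<^esub> b"
    by (intro B.le_trans[OF mono[OF r(1) q(1) r(3)] qb]) (simp_all add: closed q(1) assms(2))
  then show ?thesis using that r by blast
qed

text \<open>Inequalities can be tested on conditions: otherwise the difference of b and c is
  nonzero, and a condition with image below it would lie below both c and its complement.\<close>

lemma le_by_dense:
  assumes "b \<in> carrier B" "c \<in> carrier B"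
    and "\<And>p. p \<in> carrier P \<Longrightarrow> e p \<sqsubseteq>\<^bsub>B\<^esub> b \<Longrightarrow> e p \<sqsubseteq>\<^bsub>B\<^esub> c"
  shows "b \<sqsubseteq>\<^bsub>B\<^esub> c"
proof (rule ccontr)
  assume "\<not> b \<sqsubseteq>\<^bsub>B\<^esub> c"
  then have n: "b \<sqinter>\<^bsub>B\<^esub> complement B c \<noteq> \<bottom>\<^bsub>B\<^esub>"
    using assms B.meet_complement_nonbottom by blast
  have c': "complement B c \<in> carrier B"
    using assms B.complement_props by blast
  have m: "b \<sqinter>\<^bsub>B\<^esub> complement B c \<in> carrier B"
    using c' assms by simp
  obtain p where p: "p \<in> carrier P" "e p \<sqsubseteq>\<^bsub>B\<^esub> b \<sqinter>\<^bsub>B\<^esub> complement B c"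
    using below[OF m n] by blast
  have "e p \<sqsubseteq>\<^bsub>B\<^esub> b" "e p \<sqsubseteq>\<^bsub>B\<^esub> complement B c"
    by (rule B.le_trans[OF p(2)]; simp add: B.meet_left B.meet_right closed p(1) c' assms(1))+
  then show False
    using assms p(1) closed[OF p(1)] nonbottom[OF p(1)] c' B.complement_props(2)[of c]
      B.bottom_unless_compatible[of c "complement B c" "e p"] by blast
qed

end

text \<open>Projections in the sense of forcing. \<open>proj_lift\<close> allows refining downstairs
  and pulling the refinement back; \<open>proj_dense\<close> ensures that distinct elements of B
  stay distinct.\<close>

locale completed_projection =
  Q: boolean_completion Q B e + P: boolean_completion P C d
  for Q :: "('q, 'm) gorder_scheme" and B :: "('b, 'n) gorder_scheme" and e
    and P :: "('p, 'k) gorder_scheme" and C :: "('c, 'l) gorder_scheme" and d +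
  fixes \<pi> :: "'p \<Rightarrow> 'q"
  assumes proj_closed: "p \<in> carrier P \<Longrightarrow> \<pi> p \<in> carrier Q"
    and proj_mono: "p \<in> carrier P \<Longrightarrow> p' \<in> carrier P \<Longrightarrow> p \<sqsubseteq>\<^bsub>P\<^esub> p' \<Longrightarrow> \<pi> p \<sqsubseteq>\<^bsub>Q\<^esub> \<pi> p'"
    and proj_lift: "p \<in> carrier P \<Longrightarrow> q \<in> carrier Q \<Longrightarrow> q \<sqsubseteq>\<^bsub>Q\<^esub> \<pi> p \<Longrightarrow>
       \<exists>p'\<in>carrier P. p' \<sqsubseteq>\<^bsub>P\<^esub> p \<and> \<pi> p' \<sqsubseteq>\<^bsub>Q\<^esub> q"
    and proj_dense: "q \<in> carrier Q \<Longrightarrow> \<exists>p\<in>carrier P. \<pi> p \<sqsubseteq>\<^bsub>Q\<^esub> q"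
begin

text \<open>The Boolean value, in C, of the statement that b lies in the filter on B generated by
  the projected generic.\<close>

definition lift :: "'b \<Rightarrow> 'c" where
  "lift b = \<Squnion>\<^bsub>C\<^esub> (d ` {p \<in> carrier P. e (\<pi> p) \<sqsubseteq>\<^bsub>B\<^esub> b})"

lemma image_closed: "d ` {p \<in> carrier P. R p} \<subseteq> carrier C"
  by (auto intro: P.closed)

lemma lift_closed: "lift b \<in> carrier C"
  unfolding lift_def by (intro P.B.sup_closed image_closed)

lemma proj_closed': "p \<in> carrier P \<Longrightarrow> e (\<pi> p) \<in> carrier B"
  by (simp add: Q.closed proj_closed)

lemma proj_mono':
  "p \<in> carrier P \<Longrightarrow> p' \<in> carrier P \<Longrightarrow> p \<sqsubseteq>\<^bsub>P\<^esub> p' \<Longrightarrow> e (\<pi> p) \<sqsubseteq>\<^bsub>B\<^esub> e (\<pi> p')"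
  by (simp add: Q.mono proj_closed proj_mono)

lemma proj_refine:
  assumes p: "p \<in> carrier P" and b: "b \<in> carrier B" "e (\<pi> p) \<sqinter>\<^bsub>B\<^esub> b \<noteq> \<bottom>\<^bsub>B\<^esub>"
  obtains p' where "p' \<in> carrier P" "p' \<sqsubseteq>\<^bsub>P\<^esub> p" "e (\<pi> p') \<sqsubseteq>\<^bsub>B\<^esub> b"
proof -
  obtain q where q: "q \<in> carrier Q" "q \<sqsubseteq>\<^bsub>Q\<^esub> \<pi> p" "e q \<sqsubseteq>\<^bsub>B\<^esub> b"
    using Q.refine[OF proj_closed[OF p] b] by blast
  then obtain p' where p': "p' \<in> carrier P" "p' \<sqsubseteq>\<^bsub>P\<^esub> p" "\<pi> p' \<sqsubseteq>\<^bsub>Q\<^esub> q"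
    using proj_lift[OF p] by blast
  moreover have "e (\<pi> p') \<sqsubseteq>\<^bsub>B\<^esub> b"
    by (rule Q.B.le_trans[OF Q.mono[OF proj_closed[OF p'(1)] q(1) p'(3)] q(3)])
      (simp_all add: proj_closed' Q.closed p'(1) q(1) b(1))
  ultimately show ?thesis using that by blast
qed

text \<open>The join gains no new conditions. Otherwise p extends to p' projecting below the
  complement of b; as \<open>d p'\<close> is below the join, it is compatible with some member
  \<open>d p''\<close>, and a common extension would project below both b and its
  complement.\<close>

lemma le_lift_iff:
  assumes p: "p \<in> carrier P" and b: "b \<in> carrier B"
  shows "d p \<sqsubseteq>\<^bsub>C\<^esub> lift b \<longleftrightarrow> e (\<pi> p) \<sqsubseteq>\<^bsub>B\<^esub> b"
proof
  assume "e (\<pi> p) \<sqsubseteq>\<^bsub>B\<^esub> b"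
  then show "d p \<sqsubseteq>\<^bsub>C\<^esub> lift b"
    unfolding lift_def using p by (intro P.B.sup_upper image_closed) auto
next
  assume le: "d p \<sqsubseteq>\<^bsub>C\<^esub> lift b"
  let ?nb = "complement B b"
  note nb = Q.B.complement_props[OF b]
  show "e (\<pi> p) \<sqsubseteq>\<^bsub>B\<^esub> b"
  proof (rule ccontr)
    assume "\<not> e (\<pi> p) \<sqsubseteq>\<^bsub>B\<^esub> b"
    then have "e (\<pi> p) \<sqinter>\<^bsub>B\<^esub> ?nb \<noteq> \<bottom>\<^bsub>B\<^esub>"
      using Q.B.meet_complement_nonbottom proj_closed'[OF p] b by blast
    then obtain p' where p': "p' \<in> carrier P" "p' \<sqsubseteq>\<^bsub>P\<^esub> p" "e (\<pi> p') \<sqsubseteq>\<^bsub>B\<^esub> ?nb"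
      using proj_refine[OF p nb(1)] by blast
    have "d p' \<sqsubseteq>\<^bsub>C\<^esub> lift b"
      by (rule P.B.le_trans[OF P.mono[OF p'(1) p p'(2)] le])
        (simp_all add: P.closed p p'(1) lift_closed)
    then have "d p' \<sqinter>\<^bsub>C\<^esub> lift b \<noteq> \<bottom>\<^bsub>C\<^esub>"
      using P.B.bottom_unless_compatible[of "d p'" "lift b" "d p'"] P.closed[OF p'(1)]
        P.nonbottom[OF p'(1)] lift_closed by auto
    then obtain p'' where p'': "p'' \<in> carrier P" "e (\<pi> p'') \<sqsubseteq>\<^bsub>B\<^esub> b"
        "d p' \<sqinter>\<^bsub>C\<^esub> d p'' \<noteq> \<bottom>\<^bsub>C\<^esub>"
      using P.B.meet_sup_nonbottom[OF P.closed[OF p'(1)] image_closed,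
          of "\<lambda>p. e (\<pi> p) \<sqsubseteq>\<^bsub>B\<^esub> b"]
      unfolding lift_def by auto
    obtain r where r: "r \<in> carrier P" "r \<sqsubseteq>\<^bsub>P\<^esub> p'" "r \<sqsubseteq>\<^bsub>P\<^esub> p''"
      using P.compatible[OF p'(1) p''(1,3)] by blast
    have "e (\<pi> r) \<sqsubseteq>\<^bsub>B\<^esub> b"
      by (rule Q.B.le_trans[OF proj_mono'[OF r(1) p''(1) r(3)] p''(2)])
        (simp_all add: proj_closed' r(1) p''(1) b)
    moreover have "e (\<pi> r) \<sqsubseteq>\<^bsub>B\<^esub> ?nb"
      by (rule Q.B.le_trans[OF proj_mono'[OF r(1) p'(1) r(2)] p'(3)])
        (simp_all add: proj_closed' r(1) p'(1) nb(1))
    ultimately have "e (\<pi> r) = \<bottom>\<^bsub>B\<^esub>"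
      using Q.B.bottom_unless_compatible[OF b nb(1) proj_closed'[OF r(1)] nb(2)] by blast
    then show False
      using Q.nonbottom proj_closed r(1) by blast
  qed
qed

lemma lift_mono:
  assumes "b \<in> carrier B" "b' \<in> carrier B" "b \<sqsubseteq>\<^bsub>B\<^esub> b'"
  shows "lift b \<sqsubseteq>\<^bsub>C\<^esub> lift b'"
proof (rule P.le_by_dense[OF lift_closed lift_closed])
  fix p assume p: "p \<in> carrier P" "d p \<sqsubseteq>\<^bsub>C\<^esub> lift b"
  then have "e (\<pi> p) \<sqsubseteq>\<^bsub>B\<^esub> b"
    using le_lift_iff assms(1) by simp
  then have "e (\<pi> p) \<sqsubseteq>\<^bsub>B\<^esub> b'"
    by (rule Q.B.le_trans) (simp_all add: proj_closed' p(1) assms)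
  then show "d p \<sqsubseteq>\<^bsub>C\<^esub> lift b'"
    using le_lift_iff p(1) assms(2) by simp
qed

text \<open>Injectivity comes from here: by \<open>proj_dense\<close> some p projects below the
  difference of b and b', and \<open>le_lift_iff\<close> then puts \<open>d p\<close> below
  \<open>lift b\<close> but not below \<open>lift b'\<close>.\<close>

lemma lift_reflects:
  assumes b: "b \<in> carrier B" "b' \<in> carrier B" and le: "lift b \<sqsubseteq>\<^bsub>C\<^esub> lift b'"
  shows "b \<sqsubseteq>\<^bsub>B\<^esub> b'"
proof (rule ccontr)
  assume "\<not> b \<sqsubseteq>\<^bsub>B\<^esub> b'"
  then have n: "b \<sqinter>\<^bsub>B\<^esub> complement B b' \<noteq> \<bottom>\<^bsub>B\<^esub>"
    using b Q.B.meet_complement_nonbottom by blast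
  have c': "complement B b' \<in> carrier B"
    using b Q.B.complement_props by blast
  have m: "b \<sqinter>\<^bsub>B\<^esub> complement B b' \<in> carrier B"
    using c' b by simp
  obtain q where q: "q \<in> carrier Q" "e q \<sqsubseteq>\<^bsub>B\<^esub> b \<sqinter>\<^bsub>B\<^esub> complement B b'"
    using Q.below[OF m n] by blast
  obtain p where p: "p \<in> carrier P" "\<pi> p \<sqsubseteq>\<^bsub>Q\<^esub> q"
    using proj_dense[OF q(1)] by blast
  have ep: "e (\<pi> p) \<in> carrier B"
    using proj_closed'[OF p(1)] .
  have "e (\<pi> p) \<sqsubseteq>\<^bsub>B\<^esub> b \<sqinter>\<^bsub>B\<^esub> complement B b'"
    by (rule Q.B.le_trans[OF Q.mono[OF proj_closed[OF p(1)] q(1) p(2)] q(2)])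
      (simp_all add: Q.closed q(1) ep m)
  then have le1: "e (\<pi> p) \<sqsubseteq>\<^bsub>B\<^esub> b" and le2: "e (\<pi> p) \<sqsubseteq>\<^bsub>B\<^esub> complement B b'"
    by (rule Q.B.le_trans; simp add: Q.B.meet_left Q.B.meet_right ep c' b(1))+
  have "d p \<sqsubseteq>\<^bsub>C\<^esub> lift b'"
    by (rule P.B.le_trans[OF _ le])
      (simp_all add: le_lift_iff le1 p(1) b(1) P.closed lift_closed)
  then have "e (\<pi> p) \<sqsubseteq>\<^bsub>B\<^esub> b'"
    using le_lift_iff[OF p(1) b(2)] by blast
  then show False
    using le2 Q.B.bottom_unless_compatible[OF b(2) c' ep] Q.B.complement_props(2)[OF b(2)]
      Q.nonbottom proj_closed p(1) by blast
qed

text \<open>By \<open>le_lift_iff\<close>, \<open>d p\<close> is below either side exactly when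
  \<open>e (\<pi> p)\<close> is below every member of S; such tests suffice by
  \<open>le_by_dense\<close>.\<close>

lemma lift_Inf:
  assumes S: "S \<subseteq> carrier B"
  shows "lift (\<Sqinter>\<^bsub>B\<^esub> S) = \<Sqinter>\<^bsub>C\<^esub> (lift ` S)"
proof (rule P.B.le_antisym)
  have S': "lift ` S \<subseteq> carrier C"
    using lift_closed by blast
  have i: "\<Sqinter>\<^bsub>B\<^esub> S \<in> carrier B"
    using S by simp
  show ci: "\<Sqinter>\<^bsub>C\<^esub> (lift ` S) \<in> carrier C"
    using S' by simp
  show "lift (\<Sqinter>\<^bsub>B\<^esub> S) \<sqsubseteq>\<^bsub>C\<^esub> \<Sqinter>\<^bsub>C\<^esub> (lift ` S)"
    using S i Q.B.inf_lower[OF S]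
    by (intro P.B.inf_greatest[OF S' lift_closed]) (auto intro!: lift_mono)
  show "\<Sqinter>\<^bsub>C\<^esub> (lift ` S) \<sqsubseteq>\<^bsub>C\<^esub> lift (\<Sqinter>\<^bsub>B\<^esub> S)"
  proof (rule P.le_by_dense[OF ci lift_closed])
    fix p assume p: "p \<in> carrier P" "d p \<sqsubseteq>\<^bsub>C\<^esub> \<Sqinter>\<^bsub>C\<^esub> (lift ` S)"
    have "e (\<pi> p) \<sqsubseteq>\<^bsub>B\<^esub> b" if b: "b \<in> S" for b
    proof -
      have "\<Sqinter>\<^bsub>C\<^esub> (lift ` S) \<sqsubseteq>\<^bsub>C\<^esub> lift b"
        using P.B.inf_lower[OF S'] b by blast
      then have "d p \<sqsubseteq>\<^bsub>C\<^esub> lift b"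
        by (rule P.B.le_trans[OF p(2)]) (simp_all add: ci lift_closed P.closed p(1))
      then show ?thesis
        using le_lift_iff[OF p(1), of b] b S by auto
    qed
    then have "e (\<pi> p) \<sqsubseteq>\<^bsub>B\<^esub> \<Sqinter>\<^bsub>B\<^esub> S"
      by (intro Q.B.inf_greatest[OF S proj_closed'[OF p(1)]])
    then show "d p \<sqsubseteq>\<^bsub>C\<^esub> lift (\<Sqinter>\<^bsub>B\<^esub> S)"
      using le_lift_iff[OF p(1) i] by blast
  qed
qed (rule lift_closed)

text \<open>A condition below a join need not be below any member, so two refinements are made:
  first p is moved off the join in C, then its projection is moved below a single b in S. The result
  is below \<open>lift b\<close>, a contradiction.\<close>

lemma lift_Sup:
  assumes S: "S \<subseteq> carrier B"
  shows "lift (\<Squnion>\<^bsub>B\<^esub> S) = \<Squnion>\<^bsub>C\<^esub> (lift ` S)"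
proof (rule P.B.le_antisym)
  have S': "lift ` S \<subseteq> carrier C"
    using lift_closed by blast
  have i: "\<Squnion>\<^bsub>B\<^esub> S \<in> carrier B"
    using S by simp
  let ?c = "\<Squnion>\<^bsub>C\<^esub> (lift ` S)"
  show c: "?c \<in> carrier C"
    using S' by simp
  note nc = P.B.complement_props[OF c]
  show "?c \<sqsubseteq>\<^bsub>C\<^esub> lift (\<Squnion>\<^bsub>B\<^esub> S)"
    using S i Q.B.sup_upper[OF S]
    by (intro P.B.sup_least[OF S' lift_closed]) (auto intro!: lift_mono)
  show "lift (\<Squnion>\<^bsub>B\<^esub> S) \<sqsubseteq>\<^bsub>C\<^esub> ?c"
  proof (rule P.le_by_dense[OF lift_closed c], rule ccontr)
    fix p assume p: "p \<in> carrier P" "d p \<sqsubseteq>\<^bsub>C\<^esub> lift (\<Squnion>\<^bsub>B\<^esub> S)" "\<not> d p \<sqsubseteq>\<^bsub>C\<^esub> ?c"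
    obtain p' where p': "p' \<in> carrier P" "p' \<sqsubseteq>\<^bsub>P\<^esub> p" "d p' \<sqsubseteq>\<^bsub>C\<^esub> complement C ?c"
      using P.refine[OF p(1) nc(1) P.B.meet_complement_nonbottom[OF P.closed[OF p(1)] c p(3)]]
      by blast
    have ep': "e (\<pi> p') \<in> carrier B"
      using proj_closed'[OF p'(1)] .
    have "e (\<pi> p') \<sqsubseteq>\<^bsub>B\<^esub> \<Squnion>\<^bsub>B\<^esub> S"
      by (rule Q.B.le_trans[OF proj_mono'[OF p'(1) p(1) p'(2)]])
        (use p(2) le_lift_iff[OF p(1) i] in \<open>simp_all add: ep' proj_closed' p(1) i\<close>)
    then have "e (\<pi> p') \<sqinter>\<^bsub>B\<^esub> \<Squnion>\<^bsub>B\<^esub> S \<noteq> \<bottom>\<^bsub>B\<^esub>"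
      using Q.B.bottom_unless_compatible[OF ep' i ep'] Q.nonbottom proj_closed p'(1) ep' by auto
    then obtain b where b: "b \<in> S" "e (\<pi> p') \<sqinter>\<^bsub>B\<^esub> b \<noteq> \<bottom>\<^bsub>B\<^esub>"
      using Q.B.meet_sup_nonbottom[OF ep' S] by blast
    have bc: "b \<in> carrier B" using b S by blast
    obtain r where r: "r \<in> carrier P" "r \<sqsubseteq>\<^bsub>P\<^esub> p'" "e (\<pi> r) \<sqsubseteq>\<^bsub>B\<^esub> b"
      using proj_refine[OF p'(1) bc b(2)] by blast
    have dr: "d r \<in> carrier C" using P.closed[OF r(1)] .
    have "d r \<sqsubseteq>\<^bsub>C\<^esub> lift b"
      using r(3) le_lift_iff[OF r(1) bc] by blast
    moreover have "lift b \<sqsubseteq>\<^bsub>C\<^esub> ?c"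
      using P.B.sup_upper[OF S'] b by blast
    ultimately have "d r \<sqsubseteq>\<^bsub>C\<^esub> ?c"
      by (rule P.B.le_trans) (simp_all add: dr lift_closed c)
    moreover have "d r \<sqsubseteq>\<^bsub>C\<^esub> complement C ?c"
      by (rule P.B.le_trans[OF P.mono[OF r(1) p'(1) r(2)] p'(3)])
        (simp_all add: dr P.closed p'(1) nc(1))
    ultimately show False
      using P.B.bottom_unless_compatible[OF c nc(1) dr nc(2)] P.nonbottom[OF r(1)] by blast
  qed
qed (rule lift_closed)

theorem complete_embedding_lift: "complete_embedding B C lift"
proof -
  \<comment> \<open>Bottom and top are the join and the meet of the empty family.\<close>
  have bot: "lift \<bottom>\<^bsub>B\<^esub> = \<bottom>\<^bsub>C\<^esub>"
    using lift_Sup[of "{}"] Q.B.weak_sup_empty P.B.weak_sup_empty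
    by (simp add: Q.B.eq_is_equal P.B.eq_is_equal)
  have top: "lift \<top>\<^bsub>B\<^esub> = \<top>\<^bsub>C\<^esub>"
    using lift_Inf[of "{}"] Q.B.weak_inf_empty P.B.weak_inf_empty
    by (simp add: Q.B.eq_is_equal P.B.eq_is_equal)
  have meet: "lift (x \<sqinter>\<^bsub>B\<^esub> y) = lift x \<sqinter>\<^bsub>C\<^esub> lift y"
    if "x \<in> carrier B" "y \<in> carrier B" for x y
    using lift_Inf[of "{x, y}"] that by (simp add: meet_def)
  have join: "lift (x \<squnion>\<^bsub>B\<^esub> y) = lift x \<squnion>\<^bsub>C\<^esub> lift y"
    if "x \<in> carrier B" "y \<in> carrier B" for x y
    using lift_Sup[of "{x, y}"] that by (simp add: join_def)
  have compl: "lift (complement B x) = complement C (lift x)" if x: "x \<in> carrier B" for x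
  proof (rule P.B.complement_eq[symmetric])
    note c = Q.B.complement_props[OF x]
    show "lift x \<sqinter>\<^bsub>C\<^esub> lift (complement B x) = \<bottom>\<^bsub>C\<^esub>"
      using meet[OF x c(1)] c(2) bot by simp
    show "lift x \<squnion>\<^bsub>C\<^esub> lift (complement B x) = \<top>\<^bsub>C\<^esub>"
      using join[OF x c(1)] c(3) top by simp
  qed (rule lift_closed)+
  have "inj_on lift (carrier B)"
  proof (rule inj_onI)
    fix x y assume xy: "x \<in> carrier B" "y \<in> carrier B" "lift x = lift y"
    then have "lift x \<sqsubseteq>\<^bsub>C\<^esub> lift y" "lift y \<sqsubseteq>\<^bsub>C\<^esub> lift x"
      using lift_closed by auto
    then show "x = y"
      using lift_reflects xy Q.B.le_antisym by blast
  qed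
  moreover have "complete_lattice B" "complete_lattice C"
    by (rule Q.B.complete_lattice_axioms P.B.complete_lattice_axioms)+
  ultimately show ?thesis
    unfolding complete_embedding_def boolean_hom_def sup_pres_def inf_pres_def
    using bot top meet join compl lift_closed lift_Sup lift_Inf by auto
qed

end

section \<open>Block maps between filters\<close>

text \<open>The cut point is \<open>Suc (Max t)\<close>, or 0 for empty t. Without explicit cut
  points, end-extension is easy to carry from points to block indices.\<close>

lemma initial_segment_iff:
  assumes "finite t"
  shows "initial_segment t s \<longleftrightarrow> t \<subseteq> s \<and> (\<forall>x\<in>t. \<forall>y\<in>s - t. x < y)"
proof
  assume "initial_segment t s"
  then show "t \<subseteq> s \<and> (\<forall>x\<in>t. \<forall>y\<in>s - t. x < y)"
    unfolding initial_segment_def by auto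
next
  assume R: "t \<subseteq> s \<and> (\<forall>x\<in>t. \<forall>y\<in>s - t. x < y)"
  show "initial_segment t s"
  proof (cases "t = {}")
    case True
    then show ?thesis unfolding initial_segment_def by (intro exI[of _ 0]) auto
  next
    case False
    then have "Max t \<in> t" using assms by simp
    then have "t = s \<inter> {..<Suc (Max t)}"
      using R assms by (auto simp: less_Suc_eq_le) (meson DiffI leD)
    then show ?thesis unfolding initial_segment_def by blast
  qed
qed

text \<open>All that is used about the two ideals: \<open>contained_in\<close> puts projected side
  conditions into the filter of I, \<open>union_in\<close> permits deleting blocks when lifting, and
  the order of the blocks turns end-extensions into end-extensions.\<close>

locale block_reduction =
  fixes I J :: "nat set set" and b :: "nat \<Rightarrow> nat set"
  assumes ideal_I: "is_ideal I" and ideal_J: "is_ideal J"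
    and blocks_increasing: "m < n \<Longrightarrow> x \<in> b m \<Longrightarrow> y \<in> b n \<Longrightarrow> x < y"
    and union_in: "A \<in> I \<Longrightarrow> (\<Union>n\<in>A. b n) \<in> J"
    and contained_in: "A \<in> J \<Longrightarrow> {n. b n \<subseteq> A} \<in> I"
    and nonempty: "b n \<noteq> {}"
begin

definition hit :: "nat set \<Rightarrow> nat set" where
  "hit s = {n. b n \<inter> s \<noteq> {}}"

text \<open>\<open>fresh s A\<close> collects the indices of the blocks that an extension of the condition
  \<open>(s, A)\<close> can still hit; members of \<open>A\<close> below \<open>max s\<close> are useless for this.\<close>

definition fresh :: "nat set \<Rightarrow> nat set \<Rightarrow> nat set" where
  "fresh s A = {n. \<exists>x\<in>b n \<inter> A. \<forall>y\<in>s. y < x}"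

definition proj :: "nat set \<times> nat set \<Rightarrow> nat set \<times> nat set" where
  "proj = (\<lambda>(s, A). (hit s, fresh s A))"

lemma block_unique: "x \<in> b m \<Longrightarrow> x \<in> b n \<Longrightarrow> m = n"
  using blocks_increasing[of m n x x] blocks_increasing[of n m x x] by force

lemma finite_hit:
  assumes "finite s"
  shows "finite (hit s)"
proof -
  \<comment> \<open>Disjointness of the blocks recovers n from any point of s in \<open>b n\<close>.
    Points outside all blocks have an unspecified image, which is harmless for an inclusion.\<close>
  have "hit s \<subseteq> (\<lambda>x. THE n. x \<in> b n) ` s"
  proof
    fix n assume "n \<in> hit s"
    then obtain x where x: "x \<in> b n" "x \<in> s" unfolding hit_def by blast
    then have "(THE n. x \<in> b n) = n" using block_unique by blast
    then show "n \<in> (\<lambda>x. THE n. x \<in> b n) ` s" using x by blast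
  qed
  then show ?thesis using assms finite_surj by blast
qed

text \<open>With N bounding s, a block whose index is not fresh lies inside
  \<open>- A \<union> {..<N}\<close>, a member of J, so \<open>contained_in\<close> applies.\<close>

lemma fresh_in_dual:
  assumes "finite s" "A \<in> dual_filter J"
  shows "fresh s A \<in> dual_filter I"
proof -
  obtain N where N: "s \<subseteq> {..<N}" using assms(1) finite_nat_iff_bounded by blast
  have J: "- A \<union> {..<N} \<in> J"
    using assms(2) ideal_J unfolding is_ideal_def by (simp add: mem_dual_filter)
  have "n \<in> fresh s A" if "x \<in> b n" "x \<in> A" "N \<le> x" for n x
  proof -
    have "\<forall>y\<in>s. y < x"
      using N that(3) order_less_le_trans by blast
    then show ?thesis
      using that unfolding fresh_def by blast
  qed
  then have "- fresh s A \<subseteq> {n. b n \<subseteq> - A \<union> {..<N}}"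
    by (auto simp: not_less)
  then show ?thesis
    using contained_in[OF J] ideal_I unfolding is_ideal_def mem_dual_filter by blast
qed

text \<open>A newly hit block contains a point of A above all of s. Its index is therefore fresh,
  and it exceeds every old index because the blocks are increasing.\<close>

lemma proj_order_preserving:
  assumes "finite s" "finite s'" "initial_segment s s'" "A' \<subseteq> A" "s' - s \<subseteq> A"
  shows "initial_segment (hit s) (hit s')" "fresh s' A' \<subseteq> fresh s A" "hit s' - hit s \<subseteq> fresh s A"
proof -
  have s: "s \<subseteq> s'" "\<And>x y. x \<in> s \<Longrightarrow> y \<in> s' - s \<Longrightarrow> x < y"
    using assms initial_segment_iff by blast+
  have "m < n" if m: "m \<in> hit s" and n: "n \<in> hit s'" "n \<notin> hit s" for m n
  proof -
    obtain x y where xy: "x \<in> b m" "x \<in> s" "y \<in> b n" "y \<in> s'"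
      using m n(1) unfolding hit_def by blast
    then have "y \<notin> s" using n(2) unfolding hit_def by blast
    then have "x < y" using s(2) xy by blast
    moreover have "m \<noteq> n" using m n(2) by blast
    ultimately show ?thesis
      using blocks_increasing[of n m y x] xy by (meson less_asym nat_neq_iff)
  qed
  moreover have "hit s \<subseteq> hit s'" using s(1) unfolding hit_def by blast
  ultimately show "initial_segment (hit s) (hit s')"
    using initial_segment_iff[OF finite_hit[OF assms(1)]] by blast
  show "fresh s' A' \<subseteq> fresh s A"
    using s(1) assms(4) unfolding fresh_def by blast
  show "hit s' - hit s \<subseteq> fresh s A"
  proof
    fix n assume "n \<in> hit s' - hit s"
    then obtain y where "y \<in> b n" "y \<in> s' - s" unfolding hit_def by blast
    then show "n \<in> fresh s A"
      using s(2) assms(5) unfolding fresh_def by blast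
  qed
qed

text \<open>Each new block of t contributes one point of A above s, and A loses all blocks with
  index outside D. The latter form a set in J by \<open>union_in\<close>, and what remains of A can
  hit only blocks indexed by D.\<close>

lemma proj_lifting:
  assumes "finite s" "A \<in> dual_filter J" "finite t" "D \<in> dual_filter I"
    and "initial_segment (hit s) t" "t - hit s \<subseteq> fresh s A"
  obtains s' A' where "finite s'" "A' \<in> dual_filter J"
    "initial_segment s s'" "A' \<subseteq> A" "s' - s \<subseteq> A" "hit s' = t" "fresh s' A' \<subseteq> D"
proof -
  have "\<forall>n\<in>t - hit s. \<exists>x. x \<in> b n \<and> x \<in> A \<and> (\<forall>y\<in>s. y < x)"
    using assms(6) unfolding fresh_def by blast
  then obtain g where g: "\<And>n. n \<in> t - hit s \<Longrightarrow> g n \<in> b n \<and> g n \<in> A \<and> (\<forall>y\<in>s. y < g n)"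
    by metis
  define s' where "s' = s \<union> g ` (t - hit s)"
  define A' where "A' = A - (\<Union>n\<in>- D. b n)"
  show ?thesis
  proof (rule that[of s' A'])
    show "finite s'" unfolding s'_def using assms by simp
    have "(\<Union>n\<in>- D. b n) \<in> J"
      using union_in assms(4) by (simp add: mem_dual_filter)
    moreover have "- A' = - A \<union> (\<Union>n\<in>- D. b n)"
      unfolding A'_def by blast
    ultimately show "A' \<in> dual_filter J"
      using assms(2) ideal_J unfolding is_ideal_def mem_dual_filter by metis
    show "initial_segment s s'"
      using initial_segment_iff[OF assms(1)] g unfolding s'_def by blast
    show "A' \<subseteq> A" unfolding A'_def by blast
    show "s' - s \<subseteq> A" using g unfolding s'_def by blast
    show "fresh s' A' \<subseteq> D" unfolding fresh_def A'_def by blast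
    have "hit s \<subseteq> t" using assms(5) initial_segment_subset by blast
    moreover have "hit s \<subseteq> hit s'" unfolding hit_def s'_def by blast
    moreover have "n \<in> hit s'" if "n \<in> t - hit s" for n
      using g[OF that] that unfolding hit_def s'_def by blast
    \<comment> \<open>Each added point \<open>g m\<close> lies in block m only, so no block outside
      t is hit by accident.\<close>
    moreover have "n \<in> t" if "n \<in> hit s'" "n \<notin> hit s" for n
      using that g block_unique unfolding hit_def s'_def by blast
    ultimately show "hit s' = t" by blast
  qed
qed

section \<open>From the projection of conditions to the completions\<close>

theorem complete_embedding_RO:
  fixes B :: "'b gorder" and C :: "'c gorder"
  assumes "is_RO (Mathias_Prikry (dual_filter I)) B"
    and "is_RO (Mathias_Prikry (dual_filter J)) C"
  shows "\<exists>f. complete_embedding B C f"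
proof -
  let ?Q = "Mathias_Prikry (dual_filter I)" and ?P = "Mathias_Prikry (dual_filter J)"
  obtain e d where B: "complete_boolean_lattice B" "dense_embedding ?Q B e"
    and C: "complete_boolean_lattice C" "dense_embedding ?P C d"
    using assms unfolding is_RO_def by blast
  have lift: "\<exists>p'\<in>carrier ?P. p' \<sqsubseteq>\<^bsub>?P\<^esub> p \<and> proj p' \<sqsubseteq>\<^bsub>?Q\<^esub> q"
    if p: "p \<in> carrier ?P" and q: "q \<in> carrier ?Q" "q \<sqsubseteq>\<^bsub>?Q\<^esub> proj p" for p q
  proof -
    obtain s A t D where pq: "p = (s, A)" "q = (t, D)" by fastforce
    then have *: "finite s" "A \<in> dual_filter J" "finite t" "D \<in> dual_filter I"
      "initial_segment (hit s) t" "t - hit s \<subseteq> fresh s A"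
      using p q by (auto simp: Mathias_Prikry_def proj_def)
    obtain s' A' where "finite s'" "A' \<in> dual_filter J"
      "initial_segment s s'" "A' \<subseteq> A" "s' - s \<subseteq> A" "hit s' = t" "fresh s' A' \<subseteq> D"
      using proj_lifting[OF *] by blast
    then show ?thesis
      using pq *(3) by (intro bexI[of _ "(s', A')"])
        (auto simp: Mathias_Prikry_def proj_def initial_segment_refl)
  qed
  have UNIV_J: "UNIV \<in> dual_filter J"
    using ideal_J unfolding is_ideal_def mem_dual_filter by simp
  have "completed_projection ?Q B e ?P C d proj"
  proof (intro completed_projection.intro completed_projection_axioms.intro
      boolean_completion.intro boolean_completion_axioms.intro
      partial_order_Mathias_Prikry B C)
    show "proj p \<in> carrier ?Q" if "p \<in> carrier ?P" for p
      using that by (auto simp: Mathias_Prikry_def proj_def finite_hit fresh_in_dual)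
    show "proj p \<sqsubseteq>\<^bsub>?Q\<^esub> proj p'"
      if "p \<in> carrier ?P" "p' \<in> carrier ?P" "p \<sqsubseteq>\<^bsub>?P\<^esub> p'" for p p'
    proof -
      obtain s A s' A' where "p = (s', A')" "p' = (s, A)" by fastforce
      then show ?thesis
        using that proj_order_preserving[of s s' A' A] by (simp add: Mathias_Prikry_def proj_def)
    qed
    show "\<exists>p'\<in>carrier ?P. p' \<sqsubseteq>\<^bsub>?P\<^esub> p \<and> proj p' \<sqsubseteq>\<^bsub>?Q\<^esub> q"
      if "p \<in> carrier ?P" "q \<in> carrier ?Q" "q \<sqsubseteq>\<^bsub>?Q\<^esub> proj p" for p q
      using lift that .
    show "\<exists>p\<in>carrier ?P. proj p \<sqsubseteq>\<^bsub>?Q\<^esub> q" if q: "q \<in> carrier ?Q" for q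
    proof -
      \<comment> \<open>As blocks are nonempty, the weakest condition projects to the weakest
        condition, so density is the lifting property at that condition.\<close>
      have "proj ({}, UNIV) = ({}, UNIV)"
        using nonempty unfolding proj_def hit_def fresh_def by auto
      then have "q \<sqsubseteq>\<^bsub>?Q\<^esub> proj ({}, UNIV)"
        by (auto simp: Mathias_Prikry_def initial_segment_iff split: prod.splits)
      moreover have "({}, UNIV) \<in> carrier ?P"
        using UNIV_J by (simp add: Mathias_Prikry_def)
      ultimately show ?thesis using lift q by blast
    qed
  qed
  then show ?thesis
    using completed_projection.complete_embedding_lift by blast
qed

end

section \<open>Blocks of prescribed measure\<close>

text \<open>An infinite set of weights at least \<epsilon> would, by tallness, have an infinite
  summable subset, and then the constant \<epsilon> would be summable there.\<close>

lemma tall_summable_finite_large: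
  fixes \<mu> :: "nat \<Rightarrow> real"
  assumes "tall {X. \<mu> summable_on X}" "\<And>i. 0 \<le> \<mu> i" "0 < \<epsilon>"
  shows "finite {i. \<epsilon> \<le> \<mu> i}"
proof (rule ccontr)
  assume "infinite {i. \<epsilon> \<le> \<mu> i}"
  then obtain X where X: "X \<subseteq> {i. \<epsilon> \<le> \<mu> i}" "infinite X" "\<mu> summable_on X"
    using assms(1)[unfolded tall_def, rule_format, of "{i. \<epsilon> \<le> \<mu> i}"] by auto
  have "(\<lambda>_. \<epsilon>) summable_on X"
    by (rule summable_on_comparison_test[OF X(3)]) (use X(1) assms(3) in auto)
  then show False
    using infsum_diverge_constant[OF X(2), of \<epsilon>] assms(3) by simp
qed

text \<open>Beyond M every weight is below \<epsilon>, so the partial sums from M on, unbounded by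
  divergence, overshoot c by less than \<epsilon> when they first reach it.\<close>

lemma block_exists:
  fixes \<mu> :: "nat \<Rightarrow> real"
  assumes nonneg: "\<And>i. 0 \<le> \<mu> i" and small: "\<And>\<epsilon>. 0 < \<epsilon> \<Longrightarrow> finite {i. \<epsilon> \<le> \<mu> i}"
    and div: "\<not> \<mu> summable_on UNIV" and "0 \<le> c" "0 < \<epsilon>"
  shows "\<exists>S. finite S \<and> S \<noteq> {} \<and> S \<subseteq> {N..} \<and> c \<le> sum \<mu> S \<and> sum \<mu> S \<le> c + \<epsilon>"
proof -
  obtain K where K: "{i. \<epsilon> \<le> \<mu> i} \<subseteq> {..<K}"
    using small[OF \<open>0 < \<epsilon>\<close>] finite_nat_iff_bounded by blast
  define M where "M = max K N"
  have lt: "\<mu> i < \<epsilon>" if "M \<le> i" for i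
  proof (rule ccontr)
    assume "\<not> \<mu> i < \<epsilon>"
    then have "i < K" using subsetD[OF K, of i] by simp
    then show False using that unfolding M_def by simp
  qed
  define f where "f k = (\<Sum>i<k. \<mu> (i + M))" for k
  \<comment> \<open>Using \<open>Suc k\<close> keeps the block nonempty even for c = 0.\<close>
  have "\<exists>k. c \<le> f (Suc k)"
  proof (rule ccontr)
    assume "\<nexists>k. c \<le> f (Suc k)"
    then have bd: "f (Suc k) \<le> c" for k by (meson linear)
    have "f k \<le> c" for k
      using bd[of k] nonneg[of "k + M"] unfolding f_def by simp
    then have "summable (\<lambda>i. \<mu> (i + M))"
      unfolding f_def by (intro summableI_nonneg_bounded nonneg)
    then have "summable \<mu>" by (simp add: summable_iff_shift)
    then show False
      using div nonneg by (simp add: norm_summable_imp_summable_on)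
  qed
  then have L: "c \<le> f (Suc (LEAST k. c \<le> f (Suc k)))"
    by (rule LeastI_ex)
  define k where "k = (LEAST k. c \<le> f (Suc k))"
  have "f k \<le> c"
  proof (cases k)
    case 0
    then show ?thesis using \<open>0 \<le> c\<close> by (simp add: f_def)
  next
    case (Suc j)
    then have "\<not> c \<le> f (Suc j)" using not_less_Least[of j "\<lambda>k. c \<le> f (Suc k)"] unfolding k_def by auto
    then show ?thesis using Suc by simp
  qed
  moreover have "f (Suc k) = f k + \<mu> (k + M)" by (simp add: f_def)
  ultimately have U: "f (Suc k) \<le> c + \<epsilon>"
    using lt[of "k + M"] by simp
  let ?S = "(\<lambda>i. i + M) ` {..<Suc k}"
  have "sum \<mu> ?S = f (Suc k)"
    unfolding f_def by (subst sum.reindex) (auto simp: inj_on_def)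
  then show ?thesis
    using L U unfolding k_def[symmetric] by (intro exI[of _ ?S]) (auto simp: M_def)
qed

text \<open>Dependent choice starts each block above the maximum of the previous one. The tolerances
  \<open>(1/2) ^ n\<close> have a finite sum and so do not affect summability.\<close>

lemma blocks_exist:
  fixes \<mu> \<nu> :: "nat \<Rightarrow> real"
  assumes nonneg: "\<And>i. 0 \<le> \<mu> i" and small: "\<And>\<epsilon>. 0 < \<epsilon> \<Longrightarrow> finite {i. \<epsilon> \<le> \<mu> i}"
    and div: "\<not> \<mu> summable_on UNIV" and \<nu>: "\<And>n. 0 \<le> \<nu> n"
  obtains b :: "nat \<Rightarrow> nat set" where "\<And>n. finite (b n)" "\<And>n. b n \<noteq> {}"
    "\<And>m n x y. m < n \<Longrightarrow> x \<in> b m \<Longrightarrow> y \<in> b n \<Longrightarrow> x < y"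
    "\<And>n. \<nu> n \<le> sum \<mu> (b n)" "\<And>n. sum \<mu> (b n) \<le> \<nu> n + (1/2) ^ n"
proof -
  have ex: "\<exists>S. finite S \<and> S \<noteq> {} \<and> S \<subseteq> {N..} \<and> \<nu> n \<le> sum \<mu> S \<and> sum \<mu> S \<le> \<nu> n + (1/2) ^ n"
    for N n
    by (rule block_exists) (simp_all add: nonneg small div \<nu>)
  let ?P = "\<lambda>n S. finite S \<and> S \<noteq> {} \<and> \<nu> n \<le> sum \<mu> S \<and> sum \<mu> S \<le> \<nu> n + (1/2) ^ n"
  have "\<exists>b. \<forall>n. ?P n (b n) \<and> (\<forall>x\<in>b n. \<forall>y\<in>b (Suc n). x < y)"
  proof (rule dependent_nat_choice)
    show "\<exists>S. ?P 0 S"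
      using ex[of 0 0] by blast
    fix S :: "nat set" and n assume S: "?P n S"
    obtain T where T: "finite T" "T \<noteq> {}" "T \<subseteq> {Suc (Max S)..}"
        "\<nu> (Suc n) \<le> sum \<mu> T" "sum \<mu> T \<le> \<nu> (Suc n) + (1/2) ^ Suc n"
      using ex[of "Suc (Max S)" "Suc n"] by blast
    have "x < y" if "x \<in> S" "y \<in> T" for x y
    proof -
      have "x \<le> Max S" "Suc (Max S) \<le> y" using S T that by auto
      then show ?thesis by simp
    qed
    then show "\<exists>T. ?P (Suc n) T \<and> (\<forall>x\<in>S. \<forall>y\<in>T. x < y)"
      using T by blast
  qed
  then obtain b where "\<forall>n. ?P n (b n) \<and> (\<forall>x\<in>b n. \<forall>y\<in>b (Suc n). x < y)" ..
  then have b: "\<And>n. ?P n (b n)" and step: "\<And>n x y. x \<in> b n \<Longrightarrow> y \<in> b (Suc n) \<Longrightarrow> x < y"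
    by simp_all
  \<comment> \<open>Only neighbouring blocks are compared so far; a point of each intermediate block
    links the comparisons.\<close>
  have "x < y" if "m < n" "x \<in> b m" "y \<in> b n" for m n x y
    using that
  proof (induction n arbitrary: y)
    case (Suc n)
    obtain z where z: "z \<in> b n" using b[of n] by blast
    show ?case
    proof (cases "m = n")
      case True
      then show ?thesis using step Suc.prems by blast
    next
      case False
      then have "x < z" using Suc z by simp
      also have "z < y" using step z Suc.prems by blast
      finally show ?thesis .
    qed
  qed simp
  then show ?thesis using that b by blast
qed

section \<open>Choice of blocks for two summable ideals\<close>

theorem theorem8:
  fixes I J :: "nat set set"
    and B :: "'b gorder" and C :: "'c gorder"
  assumes "summable_ideal I" and "tall I"
    and "summable_ideal J" and "tall J"
    and "is_RO (Mathias_Prikry (dual_filter I)) B"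
    and "is_RO (Mathias_Prikry (dual_filter J)) C"
  shows "\<exists>f. complete_embedding B C f"
proof -
  obtain \<nu> :: "nat \<Rightarrow> real" where \<nu>: "\<And>i. 0 \<le> \<nu> i" "I = {X. \<nu> summable_on X}"
    using assms(1) unfolding summable_ideal_def by blast
  obtain \<mu> :: "nat \<Rightarrow> real" where \<mu>: "\<And>i. 0 \<le> \<mu> i" "J = {X. \<mu> summable_on X}"
    using assms(3) unfolding summable_ideal_def by blast
  have ideals: "is_ideal I" "is_ideal J"
    using assms unfolding summable_ideal_def by auto
  have div: "\<not> \<mu> summable_on UNIV"
    using ideals(2) \<mu>(2) unfolding is_ideal_def by blast
  have "finite {i. \<epsilon> \<le> \<mu> i}" if "0 < \<epsilon>" for \<epsilon>
    using tall_summable_finite_large[of \<mu> \<epsilon>] assms(4) \<mu> that by simp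
  then obtain b :: "nat \<Rightarrow> nat set" where b: "\<And>n. finite (b n)" "\<And>n. b n \<noteq> {}"
    "\<And>m n x y. m < n \<Longrightarrow> x \<in> b m \<Longrightarrow> y \<in> b n \<Longrightarrow> x < y"
    "\<And>n. \<nu> n \<le> sum \<mu> (b n)" "\<And>n. sum \<mu> (b n) \<le> \<nu> n + (1/2) ^ n"
    using blocks_exist[of \<mu> \<nu>] \<mu>(1) div \<nu>(1) by blast
  have disj: "disjoint_family_on b A" for A
    unfolding disjoint_family_on_def using b(3) by (metis disjoint_iff less_irrefl nat_neq_iff)
  \<comment> \<open>For disjoint finite blocks and nonnegative weights, summing over a union amounts
    to summing the block measures.\<close>
  have Union_iff: "\<mu> summable_on (\<Union>n\<in>A. b n) \<longleftrightarrow> (\<lambda>n. sum \<mu> (b n)) summable_on A" for A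
    by (rule summable_on_Union_iff) (simp_all add: b(1) \<mu>(1) disj)
  have "(\<lambda>n. (1/2 :: real) ^ n) summable_on UNIV"
    by (intro norm_summable_imp_summable_on) (simp add: summable_geometric)
  then have geom: "(\<lambda>n. (1/2 :: real) ^ n) summable_on A" for A
    using summable_on_subset by blast
  have "block_reduction I J b"
  proof
    \<comment> \<open>The upper bounds on the block measures give this inclusion, the lower bounds
      the next one.\<close>
    show "(\<Union>n\<in>A. b n) \<in> J" if "A \<in> I" for A
    proof -
      have "(\<lambda>n. \<nu> n + (1/2) ^ n) summable_on A"
        using that \<nu>(2) geom by (intro summable_on_add) auto
      then have "(\<lambda>n. sum \<mu> (b n)) summable_on A"
        by (rule summable_on_comparison_test) (use b(5) \<mu>(1) in \<open>auto intro: sum_nonneg\<close>)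
      then show ?thesis using Union_iff \<mu>(2) by simp
    qed
    show "{n. b n \<subseteq> A} \<in> I" if "A \<in> J" for A
    proof -
      have "\<mu> summable_on (\<Union>n\<in>{n. b n \<subseteq> A}. b n)"
        using that \<mu>(2) by (auto intro: summable_on_subset)
      then have "(\<lambda>n. sum \<mu> (b n)) summable_on {n. b n \<subseteq> A}"
        using Union_iff by blast
      then have "\<nu> summable_on {n. b n \<subseteq> A}"
        by (rule summable_on_comparison_test) (use b(4) \<nu>(1) in auto)
      then show ?thesis using \<nu>(2) by simp
    qed
  qed (use ideals b in blast)+
  then show ?thesis
    using block_reduction.complete_embedding_RO assms(5,6) by blast
qed

end
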